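(* Let $R$ be a commutative ring with identity, $S$ a multiplicatively closed subset of $R$, $I$ an ideal of $R$, and $K\subseteq N$ submodules of a unital $R$-module $M$ with $IM\subseteq N$. Suppose $I\ltimes N$ is a weakly $(S\ltimes K)$-primary ideal of $R\ltimes M$. Then $I$ is a weakly $S$-primary ideal of $R$, and $N$ is a weakly $S$-primary submodule of $M$ whenever $(N:_R M)\cap S=\emptyset$. Furthermore, there exists $s\in S$ such that: (i) for all $a,b\in R$, if $ab=0$, $sa\notin\sqrt{I}$ and $sb\notin I$, then $a,b\in ann(N)$; and (ii) for all $c\in R$, $m\in M$, if $cm=0$, $sc\notin\sqrt{(N:_R M)}$ and $sm\notin N$, then $c\in ann(I)$ and $m\in(0:_M I)$.
   Context: A multiplicatively closed subset of a ring is a non-empty subset closed under multiplication. The idealization $R\ltimes M$ is the commutative ring on the set $\{(r,m): r\in R, m\in M\}$ with componentwise addition and multiplication $(r,m)(s,n)=(rs,rn+sm)$. For an ideal $I$ of $R$ and a submodule $N$ of $M$ with $IM\subseteq N$, $I\ltimes N=\{(r,m): r\in I,m\in N\}$ is an ideal of $R\ltimes M$. For a submodule $K$ of $M$, $S\ltimes K=\{(s,k): s\in S,k\in K\}$ is a multiplicatively closed subset of $R\ltimes M$. $(N:_R M)=\{r\in R: rM\subseteq N\}$; $ann(N)=\{r\in R: rN=0\}$, $ann(I)=\{r\in R: rI=0\}$, $(0:_M I)=\{m\in M: Im=0\}$. A submodule $N$ of $M$ is weakly $S$-primary if $(N:_R M)\cap S=\emptyset$ and there exists a fixed $s\in S$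 such that for all $a\in R$, $m\in M$, $0\neq am\in N$ implies $sa\in\sqrt{(N:_R M)}$ or $sm\in N$. For a multiplicatively closed subset $T$ of a commutative ring $A$, an ideal $\mathfrak a$ of $A$ is weakly $T$-primary if $\mathfrak a\cap T=\emptyset$ and there is a fixed $t\in T$ such that $0\neq xy\in\mathfrak a$ ($x,y\in A$) implies $tx\in\sqrt{\mathfrak a}$ or $ty\in\mathfrak a$. *)

theory Defs
  imports "HOL-Algebra.Module" "HOL-Algebra.Ideal"
begin

definition mult_closed_subset :: "('a, 'c) ring_scheme \<Rightarrow> 'a set \<Rightarrow> bool" where
  "mult_closed_subset A T \<longleftrightarrow>
     T \<subseteq> carrier A \<and> T \<noteq> {} \<and> (\<forall>s\<in>T. \<forall>t\<in>T. s \<otimes>\<^bsub>A\<^esub> t \<in> T)"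

definition idealization ::
  "('a, 'c) ring_scheme \<Rightarrow> ('a, 'b, 'd) module_scheme \<Rightarrow> ('a \<times> 'b) ring" where
  "idealization R M =
     \<lparr> carrier = carrier R \<times> carrier M,
       mult = (\<lambda>(r, m) (s, n). (r \<otimes>\<^bsub>R\<^esub> s, (r \<odot>\<^bsub>M\<^esub> n) \<oplus>\<^bsub>M\<^esub> (s \<odot>\<^bsub>M\<^esub> m))),
       one = (\<one>\<^bsub>R\<^esub>, \<zero>\<^bsub>M\<^esub>),
       zero = (\<zero>\<^bsub>R\<^esub>, \<zero>\<^bsub>M\<^esub>),
       add = (\<lambda>(r, m) (s, n). (r \<oplus>\<^bsub>R\<^esub> s, m \<oplus>\<^bsub>M\<^esub> n)) \<rparr>"

text \<open>The submodule \<open>I M\<close>: finite sums of products, in analogy with \<open>ideal_prod\<close>.\<close>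

inductive_set ideal_smult ::
  "('a, 'b, 'd) module_scheme \<Rightarrow> 'a set \<Rightarrow> 'b set"
  for M and I where
    smult: "\<lbrakk> i \<in> I; m \<in> carrier M \<rbrakk> \<Longrightarrow> i \<odot>\<^bsub>M\<^esub> m \<in> ideal_smult M I"
  | sum: "\<lbrakk> x \<in> ideal_smult M I; y \<in> ideal_smult M I \<rbrakk> \<Longrightarrow> x \<oplus>\<^bsub>M\<^esub> y \<in> ideal_smult M I"

definition ideal_radical :: "('a, 'c) ring_scheme \<Rightarrow> 'a set \<Rightarrow> 'a set" where
  "ideal_radical A J = {x \<in> carrier A. \<exists>n::nat. n > 0 \<and> x [^]\<^bsub>A\<^esub> n \<in> J}"

text \<open>\<open>(N :\<^sub>R M)\<close>\<close>

definition residual ::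
  "('a, 'c) ring_scheme \<Rightarrow> ('a, 'b, 'd) module_scheme \<Rightarrow> 'b set \<Rightarrow> 'a set" where
  "residual R M N = {r \<in> carrier R. \<forall>m \<in> carrier M. r \<odot>\<^bsub>M\<^esub> m \<in> N}"

definition ann_ideal :: "('a, 'c) ring_scheme \<Rightarrow> 'a set \<Rightarrow> 'a set" where
  "ann_ideal R I = {r \<in> carrier R. \<forall>i \<in> I. r \<otimes>\<^bsub>R\<^esub> i = \<zero>\<^bsub>R\<^esub>}"

definition ann_submodule ::
  "('a, 'c) ring_scheme \<Rightarrow> ('a, 'b, 'd) module_scheme \<Rightarrow> 'b set \<Rightarrow> 'a set" where
  "ann_submodule R M N = {r \<in> carrier R. \<forall>n \<in> N. r \<odot>\<^bsub>M\<^esub> n = \<zero>\<^bsub>M\<^esub>}"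

text \<open>\<open>(0 :\<^sub>M I)\<close>\<close>

definition ann_in_module :: "('a, 'b, 'd) module_scheme \<Rightarrow> 'a set \<Rightarrow> 'b set" where
  "ann_in_module M I = {m \<in> carrier M. \<forall>i \<in> I. i \<odot>\<^bsub>M\<^esub> m = \<zero>\<^bsub>M\<^esub>}"

definition weakly_S_primary_ideal ::
  "('a, 'c) ring_scheme \<Rightarrow> 'a set \<Rightarrow> 'a set \<Rightarrow> bool" where
  "weakly_S_primary_ideal A T J \<longleftrightarrow>
     ideal J A \<and> J \<inter> T = {} \<and>
     (\<exists>t\<in>T. \<forall>x\<in>carrier A. \<forall>y\<in>carrier A.
        x \<otimes>\<^bsub>A\<^esub> y \<noteq> \<zero>\<^bsub>A\<^esub> \<and> x \<otimes>\<^bsub>A\<^esub> y \<in> J \<longrightarrow>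
        t \<otimes>\<^bsub>A\<^esub> x \<in> ideal_radical A J \<or> t \<otimes>\<^bsub>A\<^esub> y \<in> J)"

definition weakly_S_primary_submodule ::
  "('a, 'c) ring_scheme \<Rightarrow> ('a, 'b, 'd) module_scheme \<Rightarrow> 'a set \<Rightarrow> 'b set \<Rightarrow> bool" where
  "weakly_S_primary_submodule R M S N \<longleftrightarrow>
     submodule N R M \<and> residual R M N \<inter> S = {} \<and>
     (\<exists>s\<in>S. \<forall>a\<in>carrier R. \<forall>m\<in>carrier M.
        a \<odot>\<^bsub>M\<^esub> m \<noteq> \<zero>\<^bsub>M\<^esub> \<and> a \<odot>\<^bsub>M\<^esub> m \<in> N \<longrightarrow>
        s \<otimes>\<^bsub>R\<^esub> a \<in> ideal_radical R (residual R M N) \<or> s \<odot>\<^bsub>M\<^esub> m \<in> N)"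

lemma (in module) idealization_cring: "cring (idealization R M)"
proof (rule cringI)
  show "abelian_group (idealization R M)"
  proof (rule abelian_groupI)
    fix x assume "x \<in> carrier (idealization R M)"
    then show "\<exists>y\<in>carrier (idealization R M). y \<oplus>\<^bsub>idealization R M\<^esub> x = \<zero>\<^bsub>idealization R M\<^esub>"
      by (intro bexI[of _ "(\<ominus> fst x, \<ominus>\<^bsub>M\<^esub> snd x)"])
         (auto simp: idealization_def R.l_neg M.l_neg)
  qed (auto simp: idealization_def R.a_ac M.a_ac)
  show "comm_monoid (idealization R M)"
    by (rule comm_monoidI)
       (auto simp: idealization_def R.m_ac M.a_ac smult_r_distr smult_assoc1[symmetric])
qed (auto simp: idealization_def R.l_distr smult_l_distr smult_r_distr M.a_ac)

lemma (in module) ideal_idealization: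
  assumes I: "ideal I R" and N: "submodule N R M" and IM: "ideal_smult M I \<subseteq> N"
  shows "ideal (I \<times> N) (idealization R M)"
proof -
  interpret A: cring "idealization R M" by (rule idealization_cring)
  interpret I: ideal I R by (rule I)
  note N' = submoduleE[OF N]
  have IN: "i \<odot>\<^bsub>M\<^esub> m \<in> N" if "i \<in> I" "m \<in> carrier M" for i m
    using IM ideal_smult.smult[OF that] by blast
  have Nc: "n \<in> carrier M" if "n \<in> N" for n
    using N'(1) that by blast
  have N0: "\<zero>\<^bsub>M\<^esub> \<in> N"
    using subgroup.one_closed[OF submodule.axioms(1)[OF N]] by simp
  show ?thesis
  proof (rule idealI)
    show "ring (idealization R M)" by (rule A.ring_axioms)
    show "subgroup (I \<times> N) (add_monoid (idealization R M))"
    proof (rule A.add.subgroupI)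
      show "I \<times> N \<subseteq> carrier (idealization R M)"
        by (auto simp: idealization_def Nc I.Icarr)
      show "I \<times> N \<noteq> {}"
        using I.zero_closed N0 by blast
      fix x assume x: "x \<in> I \<times> N"
      have "\<ominus>\<^bsub>idealization R M\<^esub> x = (\<ominus> fst x, \<ominus>\<^bsub>M\<^esub> snd x)"
        using x by (intro A.minus_equality)
          (auto simp: idealization_def Nc I.Icarr R.l_neg M.l_neg)
      then show "\<ominus>\<^bsub>idealization R M\<^esub> x \<in> I \<times> N"
        using x N'(3) I.a_inv_closed by auto
    next
      fix x y assume "x \<in> I \<times> N" "y \<in> I \<times> N"
      then show "x \<oplus>\<^bsub>idealization R M\<^esub> y \<in> I \<times> N"
        using N'(5) I.a_closed by (auto simp: idealization_def)
    qed
  qed (auto simp: idealization_def I.I_l_closed I.I_r_closed intro!: N'(5) intro: IN N'(4))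
qed

lemma (in module) mult_closed_subset_idealization:
  assumes S: "mult_closed_subset R S" and K: "submodule K R M"
  shows "mult_closed_subset (idealization R M) (S \<times> K)"
proof -
  note K' = submoduleE[OF K]
  have T: "S \<subseteq> carrier R" "S \<noteq> {}" "\<And>s t. \<lbrakk>s \<in> S; t \<in> S\<rbrakk> \<Longrightarrow> s \<otimes> t \<in> S"
    using S by (auto simp: mult_closed_subset_def)
  have "S \<times> K \<subseteq> carrier (idealization R M)"
    using T(1) K'(1) by (auto simp: idealization_def)
  moreover have "x \<otimes>\<^bsub>idealization R M\<^esub> y \<in> S \<times> K" if x: "x \<in> S \<times> K" and y: "y \<in> S \<times> K" for x y
  proof -
    obtain s k t l where xy: "x = (s, k)" "y = (t, l)" "s \<in> S" "t \<in> S" "k \<in> K" "l \<in> K"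
      using x y by blast
    have "s \<odot>\<^bsub>M\<^esub> l \<in> K" "t \<odot>\<^bsub>M\<^esub> k \<in> K"
      using xy T(1) by (blast intro: K'(4))+
    then show ?thesis
      using xy T(3) K'(5) by (simp add: idealization_def)
  qed
  ultimately show ?thesis
    using T(2) K'(2) unfolding mult_closed_subset_def by blast
qed

end

theory Submission
  imports Defs
begin

(* Write (s, k) for the element of S \<ltimes> K witnessing that I \<ltimes> N is weakly primary; its first component s
   serves in all claims. Each claim applies the primary condition to one nonzero product in I \<ltimes> N:
   (a, 0)(b, 0) for I, (a, 0)(0, m) for N, (a, 0)(b, n) and (a, n)(b, 0) for (i), and
   (c, 0)(i, m) and (c + i, 0)(0, m) for (ii). The last one yields s(c + i) \<in> \<surd>I, hence sc \<in> \<surd>I. *)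

text \<open>In the expansion of the power, every term except \<open>x [^] n\<close> has a factor
  \<open>i\<close>. The induction gathers these terms into one remainder \<open>j\<close>, which
  avoids binomial coefficients.\<close>

lemma (in cring) pow_add_ideal:
  assumes I: "ideal I R" and x: "x \<in> carrier R" and i: "i \<in> I"
  shows "\<exists>j\<in>I. (x \<oplus> i) [^] (n::nat) = x [^] n \<oplus> j"
proof (induction n)
  interpret I: ideal I R by (rule I)
  case 0
  show ?case
    by (intro bexI[of _ "\<zero>"]) (auto simp: I.zero_closed)
next
  interpret I: ideal I R by (rule I)
  case (Suc n)
  then obtain j where j: "j \<in> I" "(x \<oplus> i) [^] n = x [^] n \<oplus> j" by blast
  have c: "i \<in> carrier R" "j \<in> carrier R" "x [^] n \<in> carrier R"
    using i j x I.Icarr by auto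
  have "(x \<oplus> i) [^] Suc n = x [^] Suc n \<oplus> (x [^] n \<otimes> i \<oplus> (j \<otimes> x \<oplus> j \<otimes> i))"
    unfolding nat_pow_Suc j(2) using c x by (simp add: l_distr r_distr a_ac)
  moreover have "x [^] n \<otimes> i \<oplus> (j \<otimes> x \<oplus> j \<otimes> i) \<in> I"
    using c x i j by (intro I.a_closed I.I_l_closed I.I_r_closed) auto
  ultimately show ?case by blast
qed

text \<open>Membership in the radical depends only on the class modulo \<open>I\<close>: equal
  powers of \<open>x\<close> and \<open>x \<oplus> i\<close> differ by an element of
  \<open>I\<close>, so the same exponent works.\<close>

lemma (in cring) ideal_radical_add_cancel:
  assumes I: "ideal I R" and x: "x \<in> carrier R" and i: "i \<in> I" and r: "x \<oplus> i \<in> ideal_radical R I"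
  shows "x \<in> ideal_radical R I"
proof -
  interpret I: ideal I R by (rule I)
  obtain n :: nat where n: "n > 0" "(x \<oplus> i) [^] n \<in> I"
    using r by (auto simp: ideal_radical_def)
  obtain j where j: "j \<in> I" "(x \<oplus> i) [^] n = x [^] n \<oplus> j"
    using pow_add_ideal[OF I x i] by blast
  have "(x [^] n \<oplus> j) \<oplus> (\<ominus> j) \<in> I"
    using n(2) j(1) unfolding j(2) by (rule I.a_closed[OF _ I.a_inv_closed])
  also have "(x [^] n \<oplus> j) \<oplus> (\<ominus> j) = x [^] n"
    using x I.Icarr[OF j(1)] by (simp add: a_assoc r_neg)
  finally show ?thesis
    using n x by (auto simp: ideal_radical_def)
qed

lemma ideal_radical_mono:
  "I \<subseteq> J \<Longrightarrow> ideal_radical R I \<subseteq> ideal_radical R J"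
  by (auto simp: ideal_radical_def)

text \<open>The first projection preserves products and one. This is read off the recursion for
  powers, so \<open>R\<close> and \<open>M\<close> may be arbitrary structures.\<close>

lemma fst_idealization_pow:
  "fst (x [^]\<^bsub>idealization R M\<^esub> (n::nat)) = fst x [^]\<^bsub>R\<^esub> n"
proof (induction n)
  case 0
  show ?case by (simp add: nat_pow_def idealization_def)
next
  case (Suc n)
  have "fst (y \<otimes>\<^bsub>idealization R M\<^esub> x) = fst y \<otimes>\<^bsub>R\<^esub> fst x" for y
    by (simp add: idealization_def split_beta)
  then show ?case
    using Suc by (simp add: nat_pow_def)
qed

lemma fst_ideal_radical_idealization:
  assumes x: "x \<in> ideal_radical (idealization R M) (I \<times> N)"
  shows "fst x \<in> ideal_radical R I"
proof -
  from x obtain n :: nat where n: "n > 0" "fst x [^]\<^bsub>R\<^esub> n \<in> I"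
    unfolding ideal_radical_def mem_Collect_eq mem_Times_iff fst_idealization_pow by blast
  have "fst x \<in> carrier R"
    using x by (auto simp: ideal_radical_def idealization_def)
  then show ?thesis
    using n unfolding ideal_radical_def by blast
qed

lemma (in module) submodule_add_cancel:
  assumes N: "submodule N R M" and x: "x \<in> carrier M" and y: "y \<in> N" and "x \<oplus>\<^bsub>M\<^esub> y \<in> N"
  shows "x \<in> N"
proof -
  note N' = submoduleE[OF N]
  have yc: "y \<in> carrier M" using N'(1) y by blast
  have "(x \<oplus>\<^bsub>M\<^esub> y) \<oplus>\<^bsub>M\<^esub> (\<ominus>\<^bsub>M\<^esub> y) \<in> N"
    by (rule N'(5)[OF assms(4) N'(3)[OF y]])
  also have "(x \<oplus>\<^bsub>M\<^esub> y) \<oplus>\<^bsub>M\<^esub> (\<ominus>\<^bsub>M\<^esub> y) = x"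
    using x yc by (simp add: M.a_assoc M.r_neg)
  finally show ?thesis .
qed

text \<open>The primary condition is rewritten in coordinates for the product of
  \<open>(a, m)\<close> and \<open>(b, n)\<close>, with the witness reduced to its first component.
  In the radical alternative only first components are kept; in the other, the contribution of
  \<open>k\<close> is cancelled inside \<open>N\<close>.\<close>

lemma (in module) weakly_primary_idealization_witness:
  assumes S: "S \<subseteq> carrier R" and N: "submodule N R M" and KN: "K \<subseteq> N"
    and W: "weakly_S_primary_ideal (idealization R M) (S \<times> K) (I \<times> N)"
  obtains s where "s \<in> S"
    and "\<And>a b m n. \<lbrakk> a \<in> carrier R; b \<in> carrier R; m \<in> carrier M; n \<in> carrier M;
           a \<otimes> b \<noteq> \<zero> \<or> a \<odot>\<^bsub>M\<^esub> n \<oplus>\<^bsub>M\<^esub> b \<odot>\<^bsub>M\<^esub> m \<noteq> \<zero>\<^bsub>M\<^esub>;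
           a \<otimes> b \<in> I; a \<odot>\<^bsub>M\<^esub> n \<oplus>\<^bsub>M\<^esub> b \<odot>\<^bsub>M\<^esub> m \<in> N \<rbrakk>
         \<Longrightarrow> s \<otimes> a \<in> ideal_radical R I \<or> s \<otimes> b \<in> I \<and> s \<odot>\<^bsub>M\<^esub> n \<in> N"
proof -
  let ?A = "idealization R M"
  obtain t where t: "t \<in> S \<times> K"
    and P: "\<And>x y. \<lbrakk> x \<in> carrier ?A; y \<in> carrier ?A; x \<otimes>\<^bsub>?A\<^esub> y \<noteq> \<zero>\<^bsub>?A\<^esub>; x \<otimes>\<^bsub>?A\<^esub> y \<in> I \<times> N \<rbrakk> \<Longrightarrow>
        t \<otimes>\<^bsub>?A\<^esub> x \<in> ideal_radical ?A (I \<times> N) \<or> t \<otimes>\<^bsub>?A\<^esub> y \<in> I \<times> N"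
    using W unfolding weakly_S_primary_ideal_def by metis
  obtain s k where t_eq: "t = (s, k)" and sk: "s \<in> S" "k \<in> K"
    using t by (elim SigmaE)
  show ?thesis
  proof (rule that[OF sk(1)])
    fix a b m n
    assume c: "a \<in> carrier R" "b \<in> carrier R" "m \<in> carrier M" "n \<in> carrier M"
      and nz: "a \<otimes> b \<noteq> \<zero> \<or> a \<odot>\<^bsub>M\<^esub> n \<oplus>\<^bsub>M\<^esub> b \<odot>\<^bsub>M\<^esub> m \<noteq> \<zero>\<^bsub>M\<^esub>"
      and mem: "a \<otimes> b \<in> I" "a \<odot>\<^bsub>M\<^esub> n \<oplus>\<^bsub>M\<^esub> b \<odot>\<^bsub>M\<^esub> m \<in> N"
    have "(s, k) \<otimes>\<^bsub>?A\<^esub> (a, m) \<in> ideal_radical ?A (I \<times> N) \<or> (s, k) \<otimes>\<^bsub>?A\<^esub> (b, n) \<in> I \<times> N"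
      unfolding t_eq[symmetric] using c nz mem by (intro P) (auto simp: idealization_def)
    then show "s \<otimes> a \<in> ideal_radical R I \<or> s \<otimes> b \<in> I \<and> s \<odot>\<^bsub>M\<^esub> n \<in> N"
    proof
      assume "(s, k) \<otimes>\<^bsub>?A\<^esub> (a, m) \<in> ideal_radical ?A (I \<times> N)"
      from fst_ideal_radical_idealization[OF this] show ?thesis
        by (simp add: idealization_def)
    next
      assume "(s, k) \<otimes>\<^bsub>?A\<^esub> (b, n) \<in> I \<times> N"
      then have "s \<otimes> b \<in> I" "s \<odot>\<^bsub>M\<^esub> n \<oplus>\<^bsub>M\<^esub> b \<odot>\<^bsub>M\<^esub> k \<in> N"
        by (auto simp: idealization_def)
      \<comment> \<open>The second component of \<open>(s, k)\<close> times \<open>(b, n)\<close>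
        carries this extra term; it lies in \<open>N\<close> because \<open>k \<in> K\<close> and
        \<open>K \<subseteq> N\<close>.\<close>
      moreover have "b \<odot>\<^bsub>M\<^esub> k \<in> N"
        using sk KN c by (intro submoduleE(4)[OF N]) auto
      moreover have "s \<odot>\<^bsub>M\<^esub> n \<in> carrier M"
        using sk S c by auto
      ultimately show ?thesis
        using submodule_add_cancel[OF N] by blast
    qed
  qed
qed

theorem theorem6:
  fixes R :: "('a, 'c) ring_scheme" and M :: "('a, 'b, 'd) module_scheme"
    and S I :: "'a set" and K N :: "'b set"
  assumes "module R M"
    and "mult_closed_subset R S"
    and "ideal I R"
    and "submodule K R M" and "submodule N R M" and "K \<subseteq> N"
    and "ideal_smult M I \<subseteq> N"
    and "weakly_S_primary_ideal (idealization R M) (S \<times> K) (I \<times> N)"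
  shows "weakly_S_primary_ideal R S I \<and>
    (residual R M N \<inter> S = {} \<longrightarrow> weakly_S_primary_submodule R M S N) \<and>
    (\<exists>s\<in>S.
      (\<forall>a\<in>carrier R. \<forall>b\<in>carrier R.
         a \<otimes>\<^bsub>R\<^esub> b = \<zero>\<^bsub>R\<^esub> \<and> s \<otimes>\<^bsub>R\<^esub> a \<notin> ideal_radical R I \<and> s \<otimes>\<^bsub>R\<^esub> b \<notin> I \<longrightarrow>
         a \<in> ann_submodule R M N \<and> b \<in> ann_submodule R M N) \<and>
      (\<forall>c\<in>carrier R. \<forall>m\<in>carrier M.
         c \<odot>\<^bsub>M\<^esub> m = \<zero>\<^bsub>M\<^esub> \<and> s \<otimes>\<^bsub>R\<^esub> c \<notin> ideal_radical R (residual R M N) \<and> s \<odot>\<^bsub>M\<^esub> m \<notin> N \<longrightarrow>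
         c \<in> ann_ideal R I \<and> m \<in> ann_in_module M I))"
proof -
  interpret module R M by (rule assms(1))
  interpret I: ideal I R by (rule assms(3))
  note N = assms(5)
  have S: "S \<subseteq> carrier R"
    using assms(2) by (simp add: mult_closed_subset_def)
  have N0: "\<zero>\<^bsub>M\<^esub> \<in> N" and K0: "\<zero>\<^bsub>M\<^esub> \<in> K"
    using subgroup.one_closed[OF submodule.axioms(1)] assms(4,5) by fastforce+
  have Nc: "n \<in> carrier M" if "n \<in> N" for n
    using submoduleE(1)[OF N] that by blast
  have IM: "i \<odot>\<^bsub>M\<^esub> m \<in> N" if "i \<in> I" "m \<in> carrier M" for i m
    using assms(7) ideal_smult.smult[OF that] by blast
  have "I \<subseteq> residual R M N"
    using IM I.Icarr by (auto simp: residual_def)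
  then have rad: "ideal_radical R I \<subseteq> ideal_radical R (residual R M N)"
    by (rule ideal_radical_mono)
  obtain s where s: "s \<in> S"
    and P: "\<And>a b m n. \<lbrakk> a \<in> carrier R; b \<in> carrier R; m \<in> carrier M; n \<in> carrier M;
           a \<otimes>\<^bsub>R\<^esub> b \<noteq> \<zero>\<^bsub>R\<^esub> \<or> a \<odot>\<^bsub>M\<^esub> n \<oplus>\<^bsub>M\<^esub> b \<odot>\<^bsub>M\<^esub> m \<noteq> \<zero>\<^bsub>M\<^esub>;
           a \<otimes>\<^bsub>R\<^esub> b \<in> I; a \<odot>\<^bsub>M\<^esub> n \<oplus>\<^bsub>M\<^esub> b \<odot>\<^bsub>M\<^esub> m \<in> N \<rbrakk>
         \<Longrightarrow> s \<otimes>\<^bsub>R\<^esub> a \<in> ideal_radical R I \<or> s \<otimes>\<^bsub>R\<^esub> b \<in> I \<and> s \<odot>\<^bsub>M\<^esub> n \<in> N"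
    using weakly_primary_idealization_witness[OF S N assms(6,8)] by blast
  have sc: "s \<in> carrier R" using s S by blast
  have prim_I: "s \<otimes>\<^bsub>R\<^esub> a \<in> ideal_radical R I \<or> s \<otimes>\<^bsub>R\<^esub> b \<in> I"
    if "a \<in> carrier R" "b \<in> carrier R" "a \<otimes>\<^bsub>R\<^esub> b \<noteq> \<zero>\<^bsub>R\<^esub>" "a \<otimes>\<^bsub>R\<^esub> b \<in> I" for a b
    using P[of a b "\<zero>\<^bsub>M\<^esub>" "\<zero>\<^bsub>M\<^esub>"] that N0 by auto
  \<comment> \<open>The radical is that of \<open>I\<close>. By \<open>rad\<close> this is stronger
    than the definition for submodules asks, and in this form it fits
    \<open>ideal_radical_add_cancel\<close> in (ii).\<close>
  have prim_N: "s \<otimes>\<^bsub>R\<^esub> a \<in> ideal_radical R I \<or> s \<odot>\<^bsub>M\<^esub> m \<in> N"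
    if "a \<in> carrier R" "m \<in> carrier M" "a \<odot>\<^bsub>M\<^esub> m \<noteq> \<zero>\<^bsub>M\<^esub>" "a \<odot>\<^bsub>M\<^esub> m \<in> N" for a m
    using P[of a "\<zero>\<^bsub>R\<^esub>" "\<zero>\<^bsub>M\<^esub>" m] that I.zero_closed by auto
  \<comment> \<open>An element \<open>r\<close> of both sets would put \<open>(r, 0)\<close> in both
    \<open>I \<times> N\<close> and \<open>S \<times> K\<close>.\<close>
  have "I \<inter> S = {}"
    using assms(8) N0 K0 unfolding weakly_S_primary_ideal_def by blast
  then have "weakly_S_primary_ideal R S I"
    unfolding weakly_S_primary_ideal_def using assms(3) s prim_I by blast
  moreover have "weakly_S_primary_submodule R M S N" if "residual R M N \<inter> S = {}"
    unfolding weakly_S_primary_submodule_def using N that s prim_N rad by blast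
  moreover have "a \<in> ann_submodule R M N \<and> b \<in> ann_submodule R M N"
    if ab: "a \<in> carrier R" "b \<in> carrier R" "a \<otimes>\<^bsub>R\<^esub> b = \<zero>\<^bsub>R\<^esub>"
      and ns: "s \<otimes>\<^bsub>R\<^esub> a \<notin> ideal_radical R I" "s \<otimes>\<^bsub>R\<^esub> b \<notin> I" for a b
  proof -
    have "a \<odot>\<^bsub>M\<^esub> n = \<zero>\<^bsub>M\<^esub> \<and> b \<odot>\<^bsub>M\<^esub> n = \<zero>\<^bsub>M\<^esub>" if n: "n \<in> N" for n
    proof -
      have "a \<odot>\<^bsub>M\<^esub> n \<in> N" "b \<odot>\<^bsub>M\<^esub> n \<in> N"
        using submoduleE(4)[OF N] ab n by auto
      \<comment> \<open>Since \<open>ab = 0\<close>, the two products are \<open>(0, an)\<close> and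
        \<open>(0, bn)\<close>. Moving \<open>n\<close> to the first factor produces
        \<open>bn\<close> while \<open>a\<close> stays on the radical side, so the same two negated
        hypotheses refute both cases.\<close>
      then show ?thesis
        using P[of a b "\<zero>\<^bsub>M\<^esub>" n] P[of a b n "\<zero>\<^bsub>M\<^esub>"] ab ns Nc[OF n] I.zero_closed by auto
    qed
    then show ?thesis
      using ab by (simp add: ann_submodule_def)
  qed
  moreover have "c \<in> ann_ideal R I \<and> m \<in> ann_in_module M I"
    if cm: "c \<in> carrier R" "m \<in> carrier M" "c \<odot>\<^bsub>M\<^esub> m = \<zero>\<^bsub>M\<^esub>"
      and ns: "s \<otimes>\<^bsub>R\<^esub> c \<notin> ideal_radical R (residual R M N)" "s \<odot>\<^bsub>M\<^esub> m \<notin> N" for c m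
  proof -
    have ns': "s \<otimes>\<^bsub>R\<^esub> c \<notin> ideal_radical R I" using ns(1) rad by blast
    have "c \<otimes>\<^bsub>R\<^esub> i = \<zero>\<^bsub>R\<^esub> \<and> i \<odot>\<^bsub>M\<^esub> m = \<zero>\<^bsub>M\<^esub>" if i: "i \<in> I" for i
    proof
      have ic: "i \<in> carrier R" using i by (rule I.Icarr)
      \<comment> \<open>The product is \<open>(ci, 0)\<close>, as \<open>cm = 0\<close>. Since
        \<open>si\<close> lies in \<open>I\<close> anyway, the contradiction comes from the second
        component: \<open>sm\<close> would lie in \<open>N\<close>.\<close>
      show "c \<otimes>\<^bsub>R\<^esub> i = \<zero>\<^bsub>R\<^esub>"
        using P[of c i "\<zero>\<^bsub>M\<^esub>" m] cm ns(2) ns' ic N0 I.I_l_closed[OF i cm(1)] by auto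
      show "i \<odot>\<^bsub>M\<^esub> m = \<zero>\<^bsub>M\<^esub>"
      proof (rule ccontr)
        assume nz: "i \<odot>\<^bsub>M\<^esub> m \<noteq> \<zero>\<^bsub>M\<^esub>"
        \<comment> \<open>Because \<open>cm = 0\<close>, replacing \<open>c\<close> by
          \<open>c + i\<close> turns the zero product into the nonzero element \<open>im\<close> of
          \<open>IM \<subseteq> N\<close>, to which \<open>prim_N\<close> applies.\<close>
        have "(c \<oplus>\<^bsub>R\<^esub> i) \<odot>\<^bsub>M\<^esub> m = i \<odot>\<^bsub>M\<^esub> m"
          using cm ic by (simp add: smult_l_distr)
        then have "s \<otimes>\<^bsub>R\<^esub> (c \<oplus>\<^bsub>R\<^esub> i) \<in> ideal_radical R I"
          using prim_N[of "c \<oplus>\<^bsub>R\<^esub> i" m] nz cm ic ns(2) IM[OF i cm(2)] by auto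
        then have "s \<otimes>\<^bsub>R\<^esub> c \<oplus>\<^bsub>R\<^esub> s \<otimes>\<^bsub>R\<^esub> i \<in> ideal_radical R I"
          using cm ic sc by (simp add: R.r_distr)
        \<comment> \<open>The summand \<open>si\<close> lies in \<open>I\<close>, so it does not
          affect membership in the radical.\<close>
        then have "s \<otimes>\<^bsub>R\<^esub> c \<in> ideal_radical R I"
          using R.ideal_radical_add_cancel[OF assms(3)] I.I_l_closed[OF i sc] cm sc by blast
        with ns' show False ..
      qed
    qed
    then show ?thesis
      using cm by (simp add: ann_ideal_def ann_in_module_def)
  qed
  ultimately show ?thesis
    using s by blast
qed

end
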